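(* Suppose that $\hat f:\hat{\mathbb Q}\to\hat{\mathbb Q}$ is a standard unit dual quaternion function, i.e. $|\hat f(\hat x)|=1$ for all $\hat x\in\hat{\mathbb Q}$ and the standard part of $\hat f(\hat x)$ depends only on the standard part of $\hat x$. Then the logarithm function $\hat x\mapsto\ln\hat f(\hat x)$ and the exponential function $\hat x\mapsto e^{\hat f(\hat x)}$ are also standard dual quaternion functions (i.e. the standard parts of their values depend only on the standard part of $\hat x$).
   Context: Dual quaternions: $\hat{\mathbb Q}$ is the set of $\hat q=q+q_d\epsilon$ with $q,q_d\in\mathbb Q$, the real quaternions (note: $\mathbb Q$ denotes quaternions here), where $\epsilon^2=0$ and $\epsilon$ commutes with quaternions; $q$ is the standard part, $q_d$ the dual part. Addition is componentwise and $(p+p_d\epsilon)(q+q_d\epsilon)=pq+(pq_d+p_dq)\epsilon$. $\mathbb Q$ is identified with the elements of $\hat{\mathbb Q}$ of zero dual part. Quaternion conjugation is $q^*$, and $|q|$ is the Euclidean magnitude. The magnitude of $\hat q$ is $|\hat q|=|q|+\frac{qq_d^*+q_dq^*}{2|q|}\epsilon$ if $q\ne0$, and $|\hat q|=|q_d|\epsilon$ otherwise. $\hat q$ is a unit dual quaternion if $|\hat q|=1$, equivalently $|q|=1$ and $qq_d^*+q_dq^*=0$. A function $\hat f(\hat x)=f(\hat x)+\epsilon f_d(\hat x)$, with $f(\hat x),f_d(\hat x)\in\mathbb Q$ the standard and dual parts, is standard if $f(\hat x)=f(x)$ for all $\hat x=x+\epsilon x_d\in\hat{\mathbb Q}$.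 Logarithm: a unit quaternion $q$ can be written as $q=\cos(\theta/2)+\sin(\theta/2)\,y$ with $\theta\in\mathbb R$ and $y=y_1\mathbf i+y_2\mathbf j+y_3\mathbf k$ an imaginary unit quaternion; the pair $(\theta,y)$ is chosen once and for all as a function of $q$ only. A unit dual quaternion can be written uniquely as $\hat q=q+\frac{\epsilon}{2}q\,p^b$ with $q$ a unit quaternion and $p^b$ an imaginary quaternion (zero real part); then $\ln\hat q:=\frac12(\theta y+\epsilon p^b)$. The exponential of a dual quaternion is given by the usual power series $e^{\hat q}=\sum_{k\ge0}\hat q^k/k!$ (convergence in the real 8-dimensional algebra $\hat{\mathbb Q}$). *)

theory Defs
  imports "HOL-Analysis.Analysis"
begin

section \<open>Quaternions\<close>

datatype quat = Quat (qRe: real) (qI: real) (qJ: real) (qK: real)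

lemma quat_eq_iff: "p = q \<longleftrightarrow> qRe p = qRe q \<and> qI p = qI q \<and> qJ p = qJ q \<and> qK p = qK q"
  by (cases p; cases q) simp

instantiation quat :: real_vector
begin

definition "0 = Quat 0 0 0 0"
definition "p + q = Quat (qRe p + qRe q) (qI p + qI q) (qJ p + qJ q) (qK p + qK q)"
definition "- p = Quat (- qRe p) (- qI p) (- qJ p) (- qK p)"
definition "p - q = Quat (qRe p - qRe q) (qI p - qI q) (qJ p - qJ q) (qK p - qK q)"
definition "r *\<^sub>R p = Quat (r * qRe p) (r * qI p) (r * qJ p) (r * qK p)"

instance
  by standard
    (simp_all add: quat_eq_iff zero_quat_def plus_quat_def uminus_quat_def minus_quat_def
      scaleR_quat_def algebra_simps)

end

instantiation quat :: real_algebra_1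
begin

definition "1 = Quat 1 0 0 0"
definition "p * q = Quat
  (qRe p * qRe q - qI p * qI q - qJ p * qJ q - qK p * qK q)
  (qRe p * qI q + qI p * qRe q + qJ p * qK q - qK p * qJ q)
  (qRe p * qJ q - qI p * qK q + qJ p * qRe q + qK p * qI q)
  (qRe p * qK q + qI p * qJ q - qJ p * qI q + qK p * qRe q)"

instance
proof
  fix p q r :: quat and a :: real
  show "p * q * r = p * (q * r)"
    unfolding quat_eq_iff times_quat_def quat.sel
    by (intro conjI; simp only: ring_distribs mult.assoc)
  show "(p + q) * r = p * r + q * r"
    by (cases p; cases q; cases r) (simp add: times_quat_def plus_quat_def algebra_simps)
  show "p * (q + r) = p * q + p * r"
    by (cases p; cases q; cases r) (simp add: times_quat_def plus_quat_def algebra_simps)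
  show "a *\<^sub>R p * q = a *\<^sub>R (p * q)"
    by (cases p; cases q) (simp add: times_quat_def scaleR_quat_def algebra_simps)
  show "p * a *\<^sub>R q = a *\<^sub>R (p * q)"
    by (cases p; cases q) (simp add: times_quat_def scaleR_quat_def algebra_simps)
qed (simp_all add: quat_eq_iff zero_quat_def one_quat_def times_quat_def)

end

lemma quat_sel_simps [simp]:
  "qRe 0 = 0" "qI 0 = 0" "qJ 0 = 0" "qK 0 = 0"
  "qRe 1 = 1" "qI 1 = 0" "qJ 1 = 0" "qK 1 = 0"
  "qRe (p + q) = qRe p + qRe q" "qI (p + q) = qI p + qI q"
  "qJ (p + q) = qJ p + qJ q" "qK (p + q) = qK p + qK q"
  "qRe (p - q) = qRe p - qRe q" "qI (p - q) = qI p - qI q"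
  "qJ (p - q) = qJ p - qJ q" "qK (p - q) = qK p - qK q"
  "qRe (- p) = - qRe p" "qI (- p) = - qI p" "qJ (- p) = - qJ p" "qK (- p) = - qK p"
  "qRe (r *\<^sub>R p) = r * qRe p" "qI (r *\<^sub>R p) = r * qI p"
  "qJ (r *\<^sub>R p) = r * qJ p" "qK (r *\<^sub>R p) = r * qK p"
  by (simp_all add: zero_quat_def one_quat_def plus_quat_def minus_quat_def uminus_quat_def
      scaleR_quat_def)

lemma quat_sel_times:
  "qRe (p * q) = qRe p * qRe q - qI p * qI q - qJ p * qJ q - qK p * qK q"
  "qI (p * q) = qRe p * qI q + qI p * qRe q + qJ p * qK q - qK p * qJ q"
  "qJ (p * q) = qRe p * qJ q - qI p * qK q + qJ p * qRe q + qK p * qI q"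
  "qK (p * q) = qRe p * qK q + qI p * qJ q - qJ p * qI q + qK p * qRe q"
  by (simp_all add: times_quat_def)

lemma quat_sel_of_real [simp]:
  "qRe (of_real r) = r" "qI (of_real r) = 0" "qJ (of_real r) = 0" "qK (of_real r) = 0"
  by (simp_all add: of_real_def)

definition qcnj :: "quat \<Rightarrow> quat" where
  "qcnj q = Quat (qRe q) (- qI q) (- qJ q) (- qK q)"

lemma qcnj_sel [simp]:
  "qRe (qcnj q) = qRe q" "qI (qcnj q) = - qI q" "qJ (qcnj q) = - qJ q" "qK (qcnj q) = - qK q"
  by (simp_all add: qcnj_def)

text \<open>With the Euclidean inner product, \<^term>\<open>norm\<close> on quaternions is the magnitude.\<close>

instantiation quat :: euclidean_space
begin

definition "inner p q = qRe p * qRe q + qI p * qI q + qJ p * qJ q + qK p * qK q"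
definition "norm (p :: quat) = sqrt (qRe p ^ 2 + qI p ^ 2 + qJ p ^ 2 + qK p ^ 2)"
definition "sgn (p :: quat) = p /\<^sub>R norm p"
definition "dist (p :: quat) q = norm (p - q)"
definition "(uniformity :: (quat \<times> quat) filter) = (INF e\<in>{0<..}. principal {(p, q). dist p q < e})"
definition "open (U :: quat set) \<longleftrightarrow> (\<forall>p\<in>U. eventually (\<lambda>(p', q). p' = p \<longrightarrow> q \<in> U) uniformity)"
definition "Basis = {Quat 1 0 0 0, Quat 0 1 0 0, Quat 0 0 1 0, Quat 0 0 0 1}"

instance
proof
  fix p q r :: quat and a :: real and U :: "quat set"
  show "dist p q = norm (p - q)" by (simp add: dist_quat_def)
  show "sgn p = p /\<^sub>R norm p" by (simp add: sgn_quat_def)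
  show "(uniformity :: (quat \<times> quat) filter) = (INF e\<in>{0<..}. principal {(p, q). dist p q < e})"
    by (simp add: uniformity_quat_def)
  show "open U \<longleftrightarrow> (\<forall>p\<in>U. eventually (\<lambda>(p', q). p' = p \<longrightarrow> q \<in> U) uniformity)"
    by (simp add: open_quat_def)
  show "inner p q = inner q p" by (simp add: inner_quat_def mult.commute)
  show "inner (p + q) r = inner p r + inner q r" by (simp add: inner_quat_def algebra_simps)
  show "inner (a *\<^sub>R p) q = a * inner p q" by (simp add: inner_quat_def algebra_simps)
  show "0 \<le> inner p p" by (simp add: inner_quat_def)
  show "inner p p = 0 \<longleftrightarrow> p = 0"
    by (simp add: inner_quat_def quat_eq_iff add_nonneg_eq_0_iff)
  show "norm p = sqrt (inner p p)"
    by (simp add: norm_quat_def inner_quat_def power2_eq_square)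
  show "finite (Basis :: quat set)" "(Basis :: quat set) \<noteq> {}"
    by (simp_all add: Basis_quat_def)
  show "p \<in> Basis \<Longrightarrow> q \<in> Basis \<Longrightarrow> inner p q = (if p = q then 1 else 0)"
    unfolding Basis_quat_def by (elim insertE emptyE) (simp_all add: inner_quat_def)
  show "(\<forall>u\<in>Basis. inner p u = 0) \<longleftrightarrow> p = 0"
    by (simp add: Basis_quat_def inner_quat_def) (simp add: quat_eq_iff)
qed

end

lemma norm_quat_squared: "norm (p :: quat) ^ 2 = qRe p ^ 2 + qI p ^ 2 + qJ p ^ 2 + qK p ^ 2"
  unfolding norm_quat_def by (rule real_sqrt_pow2) simp

lemma qcnj_mult_self: "qcnj q * q = of_real (norm q ^ 2)" "q * qcnj q = of_real (norm q ^ 2)"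
  by (simp_all add: quat_eq_iff quat_sel_times norm_quat_squared[unfolded power2_eq_square] power2_eq_square)

lemma qcnj_mult: "qcnj (p * q) = qcnj q * qcnj p"
  by (simp add: quat_eq_iff quat_sel_times)

instance quat :: real_normed_algebra_1
proof
  fix p q :: quat
  have "of_real (norm (p * q) ^ 2) = p * (q * qcnj q) * qcnj p"
    by (simp only: qcnj_mult_self(2)[symmetric] qcnj_mult mult.assoc)
  also have "\<dots> = norm q ^ 2 *\<^sub>R (p * qcnj p)"
    by (simp only: qcnj_mult_self(2)[of q] of_real_def mult_scaleR_right mult_scaleR_left mult_1_right)
  also have "\<dots> = of_real (norm p ^ 2 * norm q ^ 2)"
    by (simp only: qcnj_mult_self of_real_def scaleR_scaleR mult.commute)
  finally have "norm (p * q) ^ 2 = norm p ^ 2 * norm q ^ 2"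
    by (simp only: of_real_eq_iff)
  then have "norm (p * q) = norm p * norm q"
    unfolding power_mult_distrib[symmetric] by (rule power2_eq_imp_eq) simp_all
  then show "norm (p * q) \<le> norm p * norm q" by simp
  show "norm (1 :: quat) = 1" by (simp add: norm_quat_def)
qed


section \<open>Dual quaternions\<close>

datatype dquat = DQuat (std: quat) (dual: quat)

lemma dquat_eq_iff: "x = y \<longleftrightarrow> std x = std y \<and> dual x = dual y"
  by (cases x; cases y) simp

instantiation dquat :: real_vector
begin

definition "0 = DQuat 0 0"
definition "x + y = DQuat (std x + std y) (dual x + dual y)"
definition "- x = DQuat (- std x) (- dual x)"
definition "x - y = DQuat (std x - std y) (dual x - dual y)"
definition "r *\<^sub>R x = DQuat (r *\<^sub>R std x) (r *\<^sub>R dual x)"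

instance
  by standard
    (simp_all add: dquat_eq_iff zero_dquat_def plus_dquat_def uminus_dquat_def minus_dquat_def
      scaleR_dquat_def algebra_simps)

end

instantiation dquat :: real_algebra_1
begin

definition "1 = DQuat 1 0"
definition "x * y = DQuat (std x * std y) (std x * dual y + dual x * std y)"

instance
  by standard
    (simp_all add: dquat_eq_iff zero_dquat_def plus_dquat_def scaleR_dquat_def
      one_dquat_def times_dquat_def algebra_simps)

end

lemma dquat_sel_simps [simp]:
  "std 0 = 0" "dual 0 = 0" "std 1 = 1" "dual 1 = 0"
  "std (x + y) = std x + std y" "dual (x + y) = dual x + dual y"
  "std (x - y) = std x - std y" "dual (x - y) = dual x - dual y"
  "std (- x) = - std x" "dual (- x) = - dual x"
  "std (r *\<^sub>R x) = r *\<^sub>R std x" "dual (r *\<^sub>R x) = r *\<^sub>R dual x"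
  "std (x * y) = std x * std y" "dual (x * y) = std x * dual y + dual x * std y"
  by (simp_all add: zero_dquat_def one_dquat_def plus_dquat_def minus_dquat_def uminus_dquat_def
      scaleR_dquat_def times_dquat_def)

text \<open>
  The type-class norm below serves only to give the 8-dimensional real algebra \<^typ>\<open>dquat\<close> its
  usual topology, in which the library's \<^term>\<open>exp\<close> is the power series of the exponential.  The
  sum of the magnitudes of the two parts is submultiplicative, unlike the Euclidean norm.  It is
  not the dual-number-valued magnitude of a dual quaternion, which is \<open>dq_magnitude\<close> below.
\<close>

instantiation dquat :: real_normed_algebra_1
begin

definition "norm x = norm (std x) + norm (dual x)"
definition "sgn (x :: dquat) = x /\<^sub>R norm x"
definition "dist (x :: dquat) y = norm (x - y)"
definition "(uniformity :: (dquat \<times> dquat) filter) = (INF e\<in>{0<..}. principal {(x, y). dist x y < e})"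
definition "open (U :: dquat set) \<longleftrightarrow> (\<forall>x\<in>U. eventually (\<lambda>(x', y). x' = x \<longrightarrow> y \<in> U) uniformity)"

instance
proof
  fix x y :: dquat and a :: real and U :: "dquat set"
  show "dist x y = norm (x - y)" by (simp add: dist_dquat_def)
  show "sgn x = x /\<^sub>R norm x" by (simp add: sgn_dquat_def)
  show "(uniformity :: (dquat \<times> dquat) filter) = (INF e\<in>{0<..}. principal {(x, y). dist x y < e})"
    by (simp add: uniformity_dquat_def)
  show "open U \<longleftrightarrow> (\<forall>x\<in>U. eventually (\<lambda>(x', y). x' = x \<longrightarrow> y \<in> U) uniformity)"
    by (simp add: open_dquat_def)
  show "norm x = 0 \<longleftrightarrow> x = 0"
    by (simp add: norm_dquat_def dquat_eq_iff add_nonneg_eq_0_iff)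
  show "norm (x + y) \<le> norm x + norm y"
    using norm_triangle_ineq[of "std x" "std y"] norm_triangle_ineq[of "dual x" "dual y"]
    by (simp add: norm_dquat_def)
  show "norm (a *\<^sub>R x) = \<bar>a\<bar> * norm x" by (simp add: norm_dquat_def algebra_simps)
  have "norm (x * y) \<le> norm (std x) * norm (std y)
      + (norm (std x) * norm (dual y) + norm (dual x) * norm (std y))"
    unfolding norm_dquat_def dquat_sel_simps
    by (intro add_mono norm_triangle_le norm_mult_ineq)
  also have "\<dots> \<le> norm x * norm y" by (simp add: norm_dquat_def algebra_simps)
  finally show "norm (x * y) \<le> norm x * norm y" .
  show "norm (1 :: dquat) = 1" by (simp add: norm_dquat_def)
qed

end

lemma bounded_linear_std: "bounded_linear std"
  by (rule bounded_linear_intro[where K = 1]) (simp_all add: norm_dquat_def)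

lemma bounded_linear_dual: "bounded_linear dual"
  by (rule bounded_linear_intro[where K = 1]) (simp_all add: norm_dquat_def)

instance dquat :: banach
proof
  fix X :: "nat \<Rightarrow> dquat"
  assume X: "Cauchy X"
  obtain a where a: "(\<lambda>n. std (X n)) \<longlonglongrightarrow> a"
    using bounded_linear.Cauchy[OF bounded_linear_std X]
    by (auto simp: Cauchy_convergent_iff convergent_def)
  obtain b where b: "(\<lambda>n. dual (X n)) \<longlonglongrightarrow> b"
    using bounded_linear.Cauchy[OF bounded_linear_dual X]
    by (auto simp: Cauchy_convergent_iff convergent_def)
  have "(\<lambda>n. norm (std (X n) - a) + norm (dual (X n) - b)) \<longlonglongrightarrow> 0 + 0"
    by (intro tendsto_add tendsto_norm_zero LIM_zero a b)
  then have "X \<longlonglongrightarrow> DQuat a b"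
    by (subst LIM_zero_iff[symmetric], subst tendsto_norm_zero_iff[symmetric])
      (simp add: norm_dquat_def)
  then show "convergent X" by (auto simp: convergent_def)
qed

definition dq_of_quat :: "quat \<Rightarrow> dquat" where
  "dq_of_quat q = DQuat q 0"

definition dq_eps :: dquat where
  "dq_eps = DQuat 0 1"

lemma dq_of_quat_sel [simp]: "std (dq_of_quat q) = q" "dual (dq_of_quat q) = 0"
  by (simp_all add: dq_of_quat_def)

lemma dq_eps_sel [simp]: "std dq_eps = 0" "dual dq_eps = 1"
  by (simp_all add: dq_eps_def)

lemma dquat_decomp: "x = dq_of_quat (std x) + dq_of_quat (dual x) * dq_eps"
  by (subst dquat_eq_iff) simp

text \<open>The magnitude is a dual number; it is embedded as a dual quaternion with real parts.\<close>

definition dq_magnitude :: "dquat \<Rightarrow> dquat" where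
  "dq_magnitude x =
    (let q = std x; q\<^sub>d = dual x in
      if q \<noteq> 0
      then dq_of_quat (of_real (norm q))
           + dq_of_quat ((q * qcnj q\<^sub>d + q\<^sub>d * qcnj q) /\<^sub>R (2 * norm q)) * dq_eps
      else dq_of_quat (of_real (norm q\<^sub>d)) * dq_eps)"

definition dq_unit :: "dquat \<Rightarrow> bool" where
  "dq_unit x \<longleftrightarrow> dq_magnitude x = 1"

lemma dq_unit_iff:
  "dq_unit x \<longleftrightarrow> norm (std x) = 1 \<and> std x * qcnj (dual x) + dual x * qcnj (std x) = 0"
proof (cases "std x = 0")
  case True
  then show ?thesis by (simp add: dq_unit_def dq_magnitude_def dquat_eq_iff)
next
  case False
  have "of_real (norm (std x)) = (1 :: quat) \<longleftrightarrow> norm (std x) = 1"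
    by (metis of_real_1 of_real_eq_iff)
  with False show ?thesis
    by (simp add: dq_unit_def dq_magnitude_def Let_def dquat_eq_iff)
qed

definition dq_standard :: "(dquat \<Rightarrow> dquat) \<Rightarrow> bool" where
  "dq_standard f \<longleftrightarrow> (\<forall>x. std (f x) = std (f (dq_of_quat (std x))))"


section \<open>Logarithm of unit dual quaternions\<close>

definition polar_form :: "quat \<Rightarrow> real \<Rightarrow> quat \<Rightarrow> bool" where
  "polar_form q \<theta> y \<longleftrightarrow>
    qRe y = 0 \<and> norm y = 1 \<and> q = of_real (cos (\<theta> / 2)) + sin (\<theta> / 2) *\<^sub>R y"

text \<open>
  The pair \<open>(\<theta>, y)\<close> is not unique, so the logarithm depends on a choice of \<open>\<theta>\<close> and \<open>y\<close> as
  functions of the unit quaternion.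
\<close>

definition polar_choice :: "(quat \<Rightarrow> real) \<Rightarrow> (quat \<Rightarrow> quat) \<Rightarrow> bool" where
  "polar_choice \<theta> y \<longleftrightarrow> (\<forall>q. norm q = 1 \<longrightarrow> polar_form q (\<theta> q) (y q))"

definition dq_translation :: "dquat \<Rightarrow> quat" where
  "dq_translation x = (THE p. qRe p = 0 \<and>
     x = dq_of_quat (std x) + (1 / 2) *\<^sub>R (dq_eps * dq_of_quat (std x) * dq_of_quat p))"

definition dq_ln :: "(quat \<Rightarrow> real) \<Rightarrow> (quat \<Rightarrow> quat) \<Rightarrow> dquat \<Rightarrow> dquat" where
  "dq_ln \<theta> y x = (1 / 2) *\<^sub>R
     (dq_of_quat (\<theta> (std x) *\<^sub>R y (std x)) + dq_eps * dq_of_quat (dq_translation x))"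

lemma polar_form_exists:
  assumes "norm q = 1"
  shows "\<exists>\<theta> y. polar_form q \<theta> y"
proof -
  define v where "v = q - of_real (qRe q)"
  have v: "qRe v = 0" "qI v = qI q" "qJ v = qJ q" "qK v = qK q"
    by (simp_all add: v_def)
  have n: "qRe q ^ 2 + norm v ^ 2 = 1"
    using assms by (simp add: norm_quat_def v)
  obtain t where t: "qRe q = cos t" "norm v = sin t"
    using sincos_total_2pi[OF n] by metis
  show ?thesis
  proof (cases "v = 0")
    case True
    have "norm (Quat 0 1 0 0) = 1" by (simp add: norm_quat_def)
    with True t have "polar_form q (2 * t) (Quat 0 1 0 0)"
      by (auto simp: polar_form_def v_def)
    then show ?thesis by blast
  next
    case False
    have "q = of_real (qRe q) + norm v *\<^sub>R (v /\<^sub>R norm v)"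
      using False by (simp add: v_def)
    moreover have "norm (v /\<^sub>R norm v) = 1" "qRe (v /\<^sub>R norm v) = 0"
      using False v(1) by simp_all
    ultimately have "polar_form q (2 * t) (v /\<^sub>R norm v)"
      using t by (simp add: polar_form_def)
    then show ?thesis by blast
  qed
qed

lemma polar_choice_exists: "\<exists>\<theta> y. polar_choice \<theta> y"
  unfolding polar_choice_def using polar_form_exists by metis

lemma dq_unit_decomposition:
  assumes "dq_unit x"
  shows "\<exists>!p. qRe p = 0 \<and>
    x = dq_of_quat (std x) + (1 / 2) *\<^sub>R (dq_eps * dq_of_quat (std x) * dq_of_quat p)"
proof -
  have n: "qcnj (std x) * std x = 1" "std x * qcnj (std x) = 1"
    using assms by (simp_all add: dq_unit_iff qcnj_mult_self)
  have "dual x = (1 / 2) *\<^sub>R (std x * p) \<longleftrightarrow> p = 2 *\<^sub>R (qcnj (std x) * dual x)" for p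
  proof
    assume "dual x = (1 / 2) *\<^sub>R (std x * p)"
    then have "2 *\<^sub>R (qcnj (std x) * dual x) = (qcnj (std x) * std x) * p"
      by (simp add: mult.assoc)
    then show "p = 2 *\<^sub>R (qcnj (std x) * dual x)" by (simp add: n)
  next
    assume "p = 2 *\<^sub>R (qcnj (std x) * dual x)"
    then have "(1 / 2) *\<^sub>R (std x * p) = (std x * qcnj (std x)) * dual x"
      by (simp add: mult.assoc)
    then show "dual x = (1 / 2) *\<^sub>R (std x * p)" by (simp add: n)
  qed
  moreover have "qRe (2 *\<^sub>R (qcnj (std x) * dual x)) = 0"
  proof -
    have "qRe (std x * qcnj (dual x) + dual x * qcnj (std x)) = 0"
      using assms by (simp add: dq_unit_iff)
    moreover have "qRe (2 *\<^sub>R (qcnj (std x) * dual x))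
        = qRe (std x * qcnj (dual x) + dual x * qcnj (std x))"
      by (simp add: quat_sel_times)
    ultimately show ?thesis by (simp only:)
  qed
  moreover have "x = dq_of_quat (std x) + (1 / 2) *\<^sub>R (dq_eps * dq_of_quat (std x) * dq_of_quat p)
      \<longleftrightarrow> dual x = (1 / 2) *\<^sub>R (std x * p)" for p
    by (subst dquat_eq_iff) simp
  ultimately show ?thesis by metis
qed

end

theory Submission
  imports Defs
begin

text \<open>Taking standard parts is a continuous algebra homomorphism onto the quaternions. If
  \<open>std (g x)\<close> is a function of \<open>std x\<close> alone, then composing
  \<open>g\<close> with a standard function is again standard (\<open>dq_standard_compose\<close>);
  \<open>std_dq_ln\<close> and \<open>std_exp\<close> supply this for both functions.\<close>

lemma std_power: "std (x ^ n) = std x ^ n"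
  by (induction n) simp_all

text \<open>The bounded linear map \<open>std\<close> passes through the exponential series
  termwise, and \<open>std_power\<close> identifies the terms.\<close>

lemma std_exp: "std (exp x) = exp (std x)"
proof -
  have "(\<lambda>n. std (x ^ n /\<^sub>R fact n)) sums std (exp x)"
    by (rule bounded_linear.sums[OF bounded_linear_std exp_converges])
  then have "(\<lambda>n. std x ^ n /\<^sub>R fact n) sums std (exp x)"
    by (simp add: std_power)
  then show ?thesis
    using exp_converges sums_unique2 by blast
qed

text \<open>The factor \<open>dq_eps\<close> confines the translation to the dual part.\<close>

lemma std_dq_ln: "std (dq_ln \<theta> y x) = (1 / 2) *\<^sub>R (\<theta> (std x) *\<^sub>R y (std x))"
  by (simp add: dq_ln_def)

lemma dq_standard_compose:
  assumes "dq_standard f" and "\<And>x. std (g x) = h (std x)"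
  shows "dq_standard (\<lambda>x. g (f x))"
  using assms unfolding dq_standard_def by metis

theorem theorem3p4:
  fixes f :: "dquat \<Rightarrow> dquat" and \<theta> :: "quat \<Rightarrow> real" and y :: "quat \<Rightarrow> quat"
  assumes "polar_choice \<theta> y"
    and "dq_standard f"
    and "\<And>x. dq_unit (f x)"
  shows "dq_standard (\<lambda>x. dq_ln \<theta> y (f x)) \<and> dq_standard (\<lambda>x. exp (f x))"
proof
  show "dq_standard (\<lambda>x. dq_ln \<theta> y (f x))"
    by (rule dq_standard_compose[where g = "dq_ln \<theta> y" and h = "\<lambda>q. (1 / 2) *\<^sub>R (\<theta> q *\<^sub>R y q)",
          OF assms(2) std_dq_ln])
  show "dq_standard (\<lambda>x. exp (f x))"
    by (rule dq_standard_compose[where g = exp and h = exp, OF assms(2) std_exp])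
qed

end
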